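(* Let $G=(V,E)$ be a finite graph. For $r\in\mathbb{N}\cup\{\infty\}$ we have $$\gamma_r^{\mathrm{col}}(G)=\min\{k\in\mathbb{N}:\ \xi_r^{\mathrm{stab}}(G\Box K_k)=|V|\}.$$
   Context: $[k]=\{1,\dots,k\}$, and $K_k$ is the complete graph on $[k]$. The Cartesian product $G\Box K_k$ has vertex set $V\times[k]$, with $(i,c)$ and $(j,c')$ adjacent if ($\{i,j\}\in E$ and $c=c'$) or ($i=j$ and $c\ne c'$). For a finite set $\mathbf{x}$ of noncommuting variables and $m\in\mathbb{N}\cup\{\infty\}$, $\mathbb{R}\langle\mathbf{x}\rangle_m$ is the space of real noncommutative polynomials of degree at most $m$ (all polynomials if $m=\infty$), with involution $*$ reversing words and fixing the variables. A linear functional $L\in\mathbb{R}\langle\mathbf{x}\rangle_{2r}^*$ is symmetric if $L(w)=L(w^* )$ for all words $w$ of degree at most $2r$, tracial if $L(ww')=L(w'w)$ for all words with $\deg(ww')\le2r$, and positive if $L(p^*p)\ge0$ for all $p$ of degree at most $r$. For a set $\mathcal{H}$ of polynomials, $\mathcal{I}_{2r}(\mathcal{H})=\{ph:p\in\mathbb{R}\langle\mathbf{x}\rangle,h\in\mathcal{H},\deg(ph)\le2r\}$. For $r=\infty$ there are no degree restrictions. For a graph $F=(W,E_F)$, with variables $\mathbf{x}=(x_v:v\in W)$, let $\mathcal{H}_F=\{x_v-x_v^2:v\in W\}\cup\{x_vx_w:\{v,w\}\in E_F\}$ and $$\xi_r^{\mathrm{stab}}(F)=\sup\Big\{L\Big(\sum_{v\in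 W}x_v\Big):L\in\mathbb{R}\langle\mathbf{x}\rangle_{2r}^*\text{ tracial, symmetric, positive},\ L(1)=1,\ L=0\text{ on }\mathcal{I}_{2r}(\mathcal{H}_F)\Big\}.$$ Let $$\mathcal{H}^{\mathrm{col}}_{G,k}=\Big\{1-\sum_{c\in[k]}x_i^c:i\in V\Big\}\cup\{x_i^cx_j^{c'}:(c\ne c'\text{ and }i=j)\text{ or }(c=c'\text{ and }\{i,j\}\in E)\}.$$ Then $\gamma_r^{\mathrm{col}}(G)$ is the smallest $k\in\mathbb{N}$ for which there is a symmetric, tracial, positive $L\in\mathbb{R}\langle\{x_i^c:i\in V,c\in[k]\}\rangle_{2r}^*$ with $L(1)=1$ and $L=0$ on $\mathcal{I}_{2r}(\mathcal{H}^{\mathrm{col}}_{G,k})$. *)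

theory Defs
  imports "HOL-Analysis.Analysis" "HOL-Library.Poly_Mapping" "HOL-Library.Extended_Nat"
begin

text \<open>
  Words are lists, made into the free monoid (written additively, so that the convolution product
  of finitely supported functions from \<^theory>\<open>HOL-Library.Poly_Mapping\<close> applies). The type
  of finitely supported real functions on words is then the free algebra: its ring structure
  is the library's one.
\<close>

instantiation list :: (type) monoid_add
begin

definition zero_list_def: "0 = []"

definition plus_list_def: "u + v = u @ v"

instance
  by standard (simp_all add: zero_list_def plus_list_def)

end

type_synonym 'v ncpoly = "'v list \<Rightarrow>\<^sub>0 real"

definition nc_word :: "'v list \<Rightarrow> 'v ncpoly" where
  "nc_word w = Poly_Mapping.single w 1"

definition nc_var :: "'v \<Rightarrow> 'v ncpoly" where
  "nc_var v = nc_word [v]"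

definition nc_const :: "real \<Rightarrow> 'v ncpoly" where
  "nc_const a = Poly_Mapping.single [] a"

text \<open>The involution: the coefficient of \<open>w\<close> in \<open>nc_star p\<close> is that of \<open>rev w\<close> in \<open>p\<close>.\<close>

definition nc_star :: "'v ncpoly \<Rightarrow> 'v ncpoly" where
  "nc_star p = Poly_Mapping.map_key rev p"

lemma lookup_nc_star: "Poly_Mapping.lookup (nc_star p) w = Poly_Mapping.lookup p (rev w)"
  unfolding nc_star_def by (subst map_key.rep_eq) (simp_all add: inj_on_def)

lemma nc_star_word: "nc_star (nc_word w) = nc_word (rev w)"
  by (rule poly_mapping_eqI)
    (auto simp: lookup_nc_star nc_word_def lookup_single when_def)

lemma nc_word_append: "nc_word (u @ v) = nc_word u * nc_word v"
  by (simp add: nc_word_def mult_single plus_list_def)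

lemma nc_const_1: "nc_const 1 = 1"
  by (simp add: nc_const_def zero_list_def flip: single_one)

text \<open>
  The polynomials in the variables \<open>X\<close> of degree at most \<open>m\<close>. The zero polynomial belongs to
  every such space.
\<close>

definition nc_words :: "'v set \<Rightarrow> enat \<Rightarrow> 'v list set" where
  "nc_words X m = {w. set w \<subseteq> X \<and> enat (length w) \<le> m}"

definition nc_polys :: "'v set \<Rightarrow> enat \<Rightarrow> 'v ncpoly set" where
  "nc_polys X m = {p. Poly_Mapping.keys p \<subseteq> nc_words X m}"

text \<open>
  A linear functional on a truncated space is represented by a function on all polynomials of
  which only the values on that space are constrained (or used) below.
\<close>

definition linear_functional :: "'v set \<Rightarrow> enat \<Rightarrow> ('v ncpoly \<Rightarrow> real) \<Rightarrow> bool" where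
  "linear_functional X m L \<longleftrightarrow>
     (\<forall>p\<in>nc_polys X m. \<forall>q\<in>nc_polys X m. L (p + q) = L p + L q) \<and>
     (\<forall>a. \<forall>p\<in>nc_polys X m. L (nc_const a * p) = a * L p)"

definition symmetric_functional :: "'v set \<Rightarrow> enat \<Rightarrow> ('v ncpoly \<Rightarrow> real) \<Rightarrow> bool" where
  "symmetric_functional X m L \<longleftrightarrow>
     (\<forall>w\<in>nc_words X m. L (nc_word w) = L (nc_star (nc_word w)))"

definition tracial_functional :: "'v set \<Rightarrow> enat \<Rightarrow> ('v ncpoly \<Rightarrow> real) \<Rightarrow> bool" where
  "tracial_functional X m L \<longleftrightarrow>
     (\<forall>u v. u @ v \<in> nc_words X m \<longrightarrow> L (nc_word u * nc_word v) = L (nc_word v * nc_word u))"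

text \<open>Here \<open>r\<close> bounds the degree of \<open>p\<close>, so that \<open>L\<close> is applied in degree at most \<open>2 * r\<close>.\<close>

definition positive_functional :: "'v set \<Rightarrow> enat \<Rightarrow> ('v ncpoly \<Rightarrow> real) \<Rightarrow> bool" where
  "positive_functional X r L \<longleftrightarrow> (\<forall>p\<in>nc_polys X r. L (nc_star p * p) \<ge> 0)"

text \<open>The truncated left ideal; as in the source it is not closed under sums.\<close>

definition truncated_ideal :: "'v set \<Rightarrow> enat \<Rightarrow> 'v ncpoly set \<Rightarrow> 'v ncpoly set" where
  "truncated_ideal X m H = {p * h | p h. p \<in> nc_polys X \<infinity> \<and> h \<in> H \<and> p * h \<in> nc_polys X m}"

definition tracial_states :: "'v set \<Rightarrow> enat \<Rightarrow> 'v ncpoly set \<Rightarrow> ('v ncpoly \<Rightarrow> real) set" where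
  "tracial_states X r H =
     {L. linear_functional X (2 * r) L \<and> tracial_functional X (2 * r) L \<and>
         symmetric_functional X (2 * r) L \<and> positive_functional X r L \<and>
         L 1 = 1 \<and> (\<forall>q\<in>truncated_ideal X (2 * r) H. L q = 0)}"

definition finite_graph :: "'v set \<Rightarrow> 'v set set \<Rightarrow> bool" where
  "finite_graph V E \<longleftrightarrow> finite V \<and> (\<forall>e\<in>E. e \<subseteq> V \<and> card e = 2)"

text \<open>Vertices and edges of the Cartesian product of a graph with the complete graph on \<open>{1..k}\<close>.\<close>

definition box_complete_verts :: "'v set \<Rightarrow> nat \<Rightarrow> ('v \<times> nat) set" where
  "box_complete_verts V k = V \<times> {1..k}"

definition box_complete_edges :: "'v set \<Rightarrow> 'v set set \<Rightarrow> nat \<Rightarrow> ('v \<times> nat) set set" where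
  "box_complete_edges V E k =
     {{(i, c), (j, c')} | i j c c'. i \<in> V \<and> j \<in> V \<and> c \<in> {1..k} \<and> c' \<in> {1..k} \<and>
        (({i, j} \<in> E \<and> c = c') \<or> (i = j \<and> c \<noteq> c'))}"

lemma finite_graph_box_complete:
  assumes "finite_graph V E"
  shows "finite_graph (box_complete_verts V k) (box_complete_edges V E k)"
  using assms
  by (fastforce simp: finite_graph_def box_complete_verts_def box_complete_edges_def card_2_iff
        doubleton_eq_iff)

definition stab_relations :: "'v set \<Rightarrow> 'v set set \<Rightarrow> 'v ncpoly set" where
  "stab_relations W F =
     {nc_var v - nc_var v ^ 2 | v. v \<in> W} \<union> {nc_var v * nc_var w | v w. {v, w} \<in> F}"

text \<open>
  The supremum is taken in the extended reals. The definition is meaningful for \<open>r \<ge> 1\<close> only,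
  since \<open>L\<close> is applied to a polynomial of degree 1.
\<close>

definition xi_stab :: "enat \<Rightarrow> 'v set \<Rightarrow> 'v set set \<Rightarrow> ereal" where
  "xi_stab r W F =
     (SUP L \<in> tracial_states W r (stab_relations W F). ereal (L (\<Sum>v\<in>W. nc_var v)))"

text \<open>The variable \<open>(i, c)\<close> stands for \<open>x\<^sub>i\<^sup>c\<close>.\<close>

definition col_relations :: "'v set \<Rightarrow> 'v set set \<Rightarrow> nat \<Rightarrow> ('v \<times> nat) ncpoly set" where
  "col_relations V E k =
     {1 - (\<Sum>c\<in>{1..k}. nc_var (i, c)) | i. i \<in> V} \<union>
     {nc_var (i, c) * nc_var (j, c') | i j c c'.
        i \<in> V \<and> j \<in> V \<and> c \<in> {1..k} \<and> c' \<in> {1..k} \<and>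
        ((c \<noteq> c' \<and> i = j) \<or> (c = c' \<and> {i, j} \<in> E))}"

definition col_feasible :: "enat \<Rightarrow> 'v set \<Rightarrow> 'v set set \<Rightarrow> nat \<Rightarrow> bool" where
  "col_feasible r V E k \<longleftrightarrow> tracial_states (V \<times> {1..k}) r (col_relations V E k) \<noteq> {}"

text \<open>The natural numbers of the source start at 1.\<close>

definition gamma_col :: "enat \<Rightarrow> 'v set \<Rightarrow> 'v set set \<Rightarrow> nat" where
  "gamma_col r V E = (LEAST k. 1 \<le> k \<and> col_feasible r V E k)"

end

(*
  For fixed k, a tracial state on the colouring relations is the same as a tracial state L on the
  stability relations of the product with L(sum of all variables) = |V|.  One direction is
  x - x^2 = x (1 - s) + (products of orthogonal variables), where s is the sum of the fibre
  containing x.  Conversely each fibre is a clique, so positivity on 1 - s gives L(s) <= 1, and the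
  value |V| forces L((1 - s)^2) = 0.  In degrees up to r, Cauchy-Schwarz then gives L(p (1 - s)) = 0;
  to reach degree 2 r - 1, write a word as u v and use L(u v (1 - s)) = L(v (1 - s) u), where
  L(u^* (1 - s)^2 u) = L((1 - s) u u^* (1 - s)) <= L((1 - s)^2) because every variable acts as a
  contraction.  The same contraction bounds all moments by 1, so the states form a compact set and
  the supremum defining xi_stab is attained.  Some k is feasible because a proper colouring with
  values in [k] gives a state by evaluation.
*)

theory Submission
  imports Defs
begin

subsection \<open>Noncommutative polynomials of bounded degree\<close>

lemma single_conv_nc_word: "Poly_Mapping.single w a = nc_const a * nc_word w"
  by (simp add: nc_const_def nc_word_def mult_single plus_list_def)

lemma ncpoly_conv_sum:
  "p = (\<Sum>w\<in>Poly_Mapping.keys p. nc_const (Poly_Mapping.lookup p w) * nc_word w)"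
  by (rule poly_mapping_eqI)
    (simp add: lookup_sum lookup_single when_def in_keys_iff flip: single_conv_nc_word)

lemma nc_const_mult_commute: "p * nc_const a = nc_const a * p"
proof -
  have "nc_word w * nc_const a = nc_const a * nc_word w" for w :: "'a list"
    by (simp add: nc_const_def nc_word_def mult_single plus_list_def)
  moreover have "nc_const b * nc_const a = nc_const a * nc_const b" for b and u :: "'a list"
    by (simp add: nc_const_def mult_single mult.commute plus_list_def)
  ultimately have "(nc_const b * nc_word w) * nc_const a = nc_const a * (nc_const b * nc_word w)"
    for b and w :: "'a list"
    by (metis mult.assoc)
  then have "(\<Sum>w\<in>Poly_Mapping.keys p. nc_const (Poly_Mapping.lookup p w) * nc_word w) * nc_const a =
      nc_const a * (\<Sum>w\<in>Poly_Mapping.keys p. nc_const (Poly_Mapping.lookup p w) * nc_word w)"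
    by (simp add: sum_distrib_left sum_distrib_right)
  then show ?thesis
    by (simp flip: ncpoly_conv_sum)
qed

lemma nc_const_mult_left_commute: "p * (nc_const a * q) = nc_const a * (p * q)"
  by (simp only: nc_const_mult_commute flip: mult.assoc)

lemma lookup_nc_const_mult:
  "Poly_Mapping.lookup (nc_const a * p) w = a * Poly_Mapping.lookup p w"
proof -
  have "nc_const a * p = Poly_Mapping.map ((*) a) p"
    by (simp add: mult_map_scale_conv_mult nc_const_def zero_list_def)
  then show ?thesis
    by (simp add: map.rep_eq when_def)
qed

section \<open>Closure properties of the truncated polynomial spaces\<close>

lemma nc_polys_zero [simp]: "0 \<in> nc_polys X m"
  by (simp add: nc_polys_def)

lemma nc_polys_one [simp]: "1 \<in> nc_polys X m"
  by (simp add: nc_polys_def nc_words_def zero_list_def flip: zero_enat_def)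

lemma nc_polys_word [simp]: "nc_word w \<in> nc_polys X m \<longleftrightarrow> w \<in> nc_words X m"
  by (simp add: nc_polys_def nc_word_def)

lemma nc_polys_var: "v \<in> X \<Longrightarrow> 1 \<le> m \<Longrightarrow> nc_var v \<in> nc_polys X m"
  by (simp add: nc_var_def nc_words_def one_enat_def)

lemma nc_polys_const [simp]: "nc_const a \<in> nc_polys X m"
  by (simp add: nc_polys_def nc_const_def nc_words_def flip: zero_enat_def)

lemma nc_polys_add [intro]: "p \<in> nc_polys X m \<Longrightarrow> q \<in> nc_polys X m \<Longrightarrow> p + q \<in> nc_polys X m"
  using keys_add[of p q] by (auto simp: nc_polys_def)

lemma nc_polys_uminus [intro]: "p \<in> nc_polys X m \<Longrightarrow> - p \<in> nc_polys X m"
  by (auto simp: nc_polys_def in_keys_iff)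

lemma nc_polys_diff [intro]: "p \<in> nc_polys X m \<Longrightarrow> q \<in> nc_polys X m \<Longrightarrow> p - q \<in> nc_polys X m"
  using nc_polys_add[of p X m "- q"] by auto

lemma nc_polys_sum [intro]:
  "(\<And>i. i \<in> I \<Longrightarrow> f i \<in> nc_polys X m) \<Longrightarrow> (\<Sum>i\<in>I. f i) \<in> nc_polys X m"
  by (induction I rule: infinite_finite_induct) auto

lemma nc_words_append:
  assumes "u \<in> nc_words X a" "v \<in> nc_words X b" "a + b \<le> m"
  shows "u @ v \<in> nc_words X m"
proof -
  have "enat (length u) + enat (length v) \<le> a + b"
    using assms by (intro add_mono) (auto simp: nc_words_def)
  with assms show ?thesis
    by (auto simp: nc_words_def)
qed

lemma nc_polys_mult:
  assumes "p \<in> nc_polys X a" "q \<in> nc_polys X b" "a + b \<le> m"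
  shows "p * q \<in> nc_polys X m"
  using keys_mult[of p q] assms nc_words_append[OF _ _ assms(3), of _ X]
  by (fastforce simp: nc_polys_def plus_list_def)

lemma nc_polys_const_mult [intro]: "p \<in> nc_polys X m \<Longrightarrow> nc_const a * p \<in> nc_polys X m"
  by (rule nc_polys_mult[of _ _ 0]) auto

lemma nc_polys_mono: "p \<in> nc_polys X a \<Longrightarrow> a \<le> b \<Longrightarrow> p \<in> nc_polys X b"
  unfolding nc_polys_def nc_words_def by (blast intro: order_trans)

text \<open>Reduces a linear statement on a truncated space to scaled words of the same space, so
  that degree bounds stay available in every case.\<close>

lemma nc_polys_induct [consumes 1, case_names zero add word]:
  assumes "p \<in> nc_polys X m" and "P 0"
    and "\<And>p q. p \<in> nc_polys X m \<Longrightarrow> q \<in> nc_polys X m \<Longrightarrow> P p \<Longrightarrow> P q \<Longrightarrow> P (p + q)"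
    and "\<And>a w. w \<in> nc_words X m \<Longrightarrow> P (nc_const a * nc_word w)"
  shows "P p"
proof -
  let ?t = "\<lambda>w. nc_const (Poly_Mapping.lookup p w) * nc_word w"
  \<comment> \<open>Membership of the partial sums travels along with \<open>P\<close>, because the
    \<open>add\<close> case needs both summands in the space.\<close>
  have "(\<Sum>w\<in>A. ?t w) \<in> nc_polys X m \<and> P (\<Sum>w\<in>A. ?t w)" if "A \<subseteq> nc_words X m" for A
    using that
  proof (induction A rule: infinite_finite_induct)
    case (insert w A)
    then have "?t w \<in> nc_polys X m"
      by (auto intro: nc_polys_const_mult)
    with insert show ?case
      using assms(3)[of "?t w" "\<Sum>w\<in>A. ?t w"] assms(4)[of w "Poly_Mapping.lookup p w"]
      by (auto intro: nc_polys_add)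
  qed (simp_all add: assms(2))
  from this[of "Poly_Mapping.keys p"] assms(1) show ?thesis
    by (simp add: nc_polys_def flip: ncpoly_conv_sum)
qed

lemma nc_polys_UNIV_infinity [simp]: "p \<in> nc_polys UNIV \<infinity>"
  by (auto simp: nc_polys_def nc_words_def)

lemma ncpoly_induct [case_names zero add word]:
  assumes "P 0" and "\<And>p q. P p \<Longrightarrow> P q \<Longrightarrow> P (p + q)" and "\<And>a w. P (nc_const a * nc_word w)"
  shows "P p"
  using nc_polys_UNIV_infinity by (rule nc_polys_induct) (simp_all add: assms)

section \<open>The involution\<close>

lemma nc_star_zero [simp]: "nc_star 0 = 0"
  by (rule poly_mapping_eqI) (simp add: lookup_nc_star)

lemma nc_star_one [simp]: "nc_star 1 = 1"
  using nc_star_word[of "[]"] by (metis nc_const_1 nc_const_def nc_word_def rev.simps(1))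

lemma nc_star_add: "nc_star (p + q) = nc_star p + nc_star q"
  by (rule poly_mapping_eqI) (simp add: lookup_nc_star lookup_add)

lemma nc_star_diff: "nc_star (p - q) = nc_star p - nc_star q"
  by (rule poly_mapping_eqI) (simp add: lookup_nc_star lookup_minus)

lemma nc_star_sum: "nc_star (\<Sum>i\<in>I. f i) = (\<Sum>i\<in>I. nc_star (f i))"
  by (induction I rule: infinite_finite_induct) (simp_all add: nc_star_add)

lemma nc_star_star [simp]: "nc_star (nc_star p) = p"
  by (rule poly_mapping_eqI) (simp add: lookup_nc_star)

lemma nc_star_var [simp]: "nc_star (nc_var v) = nc_var v"
  by (simp add: nc_var_def nc_star_word)

lemma nc_star_const_mult: "nc_star (nc_const a * p) = nc_const a * nc_star p"
  by (rule poly_mapping_eqI) (simp add: lookup_nc_star lookup_nc_const_mult)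

lemma nc_polys_star_iff [simp]: "nc_star p \<in> nc_polys X m \<longleftrightarrow> p \<in> nc_polys X m"
proof -
  have "nc_star p \<in> nc_polys X m" if "p \<in> nc_polys X m" for p
    using that unfolding nc_polys_def nc_words_def
    by (force simp: in_keys_iff lookup_nc_star subset_iff)
  from this[of p] this[of "nc_star p"] show ?thesis
    by auto
qed

text \<open>Reversal exchanges the two parts of a concatenation; linearity in \<open>q\<close> and
  then in \<open>p\<close> carries this from words to polynomials.\<close>

lemma nc_star_mult: "nc_star (p * q) = nc_star q * nc_star p"
proof -
  have 1: "nc_star (nc_word u * q) = nc_star q * nc_word (rev u)" for u and q :: "'a ncpoly"
  proof (induction q rule: ncpoly_induct)
    case (word a w)
    have "nc_word u * (nc_const a * nc_word w) = nc_const a * nc_word (u @ w)"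
      by (metis mult.assoc nc_const_mult_commute nc_word_append)
    then show ?case
      by (simp add: nc_star_const_mult nc_star_word mult.assoc flip: nc_word_append)
  qed (simp_all add: nc_star_add distrib_left distrib_right)
  show ?thesis
  proof (induction p rule: ncpoly_induct)
    case (word a w)
    have "nc_star (nc_const a * nc_word w * q) = nc_const a * (nc_star q * nc_word (rev w))"
      by (simp only: mult.assoc nc_star_const_mult 1)
    also have "\<dots> = nc_star q * nc_star (nc_const a * nc_word w)"
      by (metis nc_star_const_mult nc_star_word mult.assoc nc_const_mult_commute)
    finally show ?case .
  qed (simp_all add: nc_star_add distrib_left distrib_right)
qed

text \<open>
  Concatenating a longest word of \<open>p\<close> with a longest word of \<open>h\<close> gives a word that no other pair
  of words produces, so it does not cancel in \<open>p * h\<close>.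
\<close>

lemma nc_polys_mult_left_factor:
  assumes p: "p \<in> nc_polys X \<infinity>" "p \<noteq> 0" and ph: "p * h \<in> nc_polys X m"
    and h: "h \<in> nc_polys X (enat d)" "u \<in> Poly_Mapping.keys h" "length u = d"
  obtains a where "a + enat d \<le> m" "p \<in> nc_polys X a"
proof -
  let ?n = "Max (length ` Poly_Mapping.keys p)"
  have "Poly_Mapping.keys p \<noteq> {}"
    using p(2) by (metis ex_in_conv in_keys_iff lookup_zero poly_mapping_eqI)
  then obtain w where w: "w \<in> Poly_Mapping.keys p" "length w = ?n"
    using Max_in[of "length ` Poly_Mapping.keys p"] by fastforce
  have n: "length v \<le> length w" if "v \<in> Poly_Mapping.keys p" for v
    using that w(2) by simp
  have d: "length v \<le> length u" if "v \<in> Poly_Mapping.keys h" for v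
    using that h by (auto simp: nc_polys_def nc_words_def)
  have "Poly_Mapping.lookup (p * h) (w @ u) =
      (\<Sum>l. Poly_Mapping.lookup p l * (\<Sum>q. Poly_Mapping.lookup h q when w @ u = l @ q))"
    by (simp add: lookup_mult plus_list_def)
  also have "\<dots> = (\<Sum>l. Poly_Mapping.lookup p l * Poly_Mapping.lookup h u when l = w)"
  proof (rule Sum_any.cong)
    fix l
    have "(\<Sum>q. Poly_Mapping.lookup h q when w @ u = l @ q) = (\<Sum>q. (Poly_Mapping.lookup h q when l = w) when q = u)"
      if "l \<in> Poly_Mapping.keys p"
    proof (rule Sum_any.cong)
      fix q
      \<comment> \<open>Words of \<open>p\<close> and \<open>h\<close> are at most as long as
        \<open>w\<close> and \<open>u\<close>. Equal concatenations therefore have pieces of equal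
        length, and only one splitting contributes to the coefficient.\<close>
      have "(w @ u = l @ q) \<longleftrightarrow> l = w \<and> q = u" if "q \<in> Poly_Mapping.keys h"
      proof
        assume eq: "w @ u = l @ q"
        then have "length w + length u = length l + length q"
          by (metis length_append)
        then have "length w = length l"
          using n[OF \<open>l \<in> _\<close>] d[OF that] by simp
        with eq show "l = w \<and> q = u" by auto
      qed auto
      then show "(Poly_Mapping.lookup h q when w @ u = l @ q) =
          ((Poly_Mapping.lookup h q when l = w) when q = u)"
        by (cases "q \<in> Poly_Mapping.keys h") (auto simp: in_keys_iff when_def)
    qed
    then show "Poly_Mapping.lookup p l * (\<Sum>q. Poly_Mapping.lookup h q when w @ u = l @ q) =
        (Poly_Mapping.lookup p l * Poly_Mapping.lookup h u when l = w)"
      by (cases "l \<in> Poly_Mapping.keys p") (auto simp: in_keys_iff when_def)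
  qed
  also have "\<dots> \<noteq> 0"
    using w(1) h(2) by (simp add: in_keys_iff)
  finally have "w @ u \<in> Poly_Mapping.keys (p * h)"
    by (simp add: in_keys_iff)
  then have "enat ?n + enat d \<le> m"
    using ph w(2) h(3) by (auto simp: nc_polys_def nc_words_def)
  moreover have "p \<in> nc_polys X (enat ?n)"
    using p(1) n w(2) by (auto simp: nc_polys_def nc_words_def)
  ultimately show ?thesis
    by (rule that)
qed

subsection \<open>Linear functionals and truncated tracial states\<close>

text \<open>Linearity on all polynomials, stronger than \<open>linear_functional\<close>, lets
  identities pass through \<open>L\<close> without degree conditions.\<close>

locale ncpoly_functional = additive L for L :: "'v ncpoly \<Rightarrow> real" +
  assumes const_mult: "L (nc_const a * p) = a * L p"

text \<open>A functional is encoded by its moments, its values on words. These range over a product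
  of real lines, which supplies the topology for the compactness argument; point evaluations are
  built in the same way.\<close>

definition nc_extend :: "('v list \<Rightarrow> real) \<Rightarrow> 'v ncpoly \<Rightarrow> real" where
  "nc_extend l p = (\<Sum>w\<in>Poly_Mapping.keys p. Poly_Mapping.lookup p w * l w)"

lemma nc_extend_superset:
  assumes "finite A" "Poly_Mapping.keys p \<subseteq> A"
  shows "nc_extend l p = (\<Sum>w\<in>A. Poly_Mapping.lookup p w * l w)"
  unfolding nc_extend_def using assms by (intro sum.mono_neutral_left) (auto simp: in_keys_iff)

interpretation nc_extend: ncpoly_functional "nc_extend l"
proof
  fix p q :: "'a ncpoly" and a
  let ?A = "Poly_Mapping.keys p \<union> Poly_Mapping.keys q"
  show "nc_extend l (p + q) = nc_extend l p + nc_extend l q"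
    using keys_add[of p q]
    by (simp add: nc_extend_superset[of ?A] lookup_add distrib_right sum.distrib)
  have "Poly_Mapping.keys (nc_const a * p) \<subseteq> Poly_Mapping.keys p"
    by (auto simp: in_keys_iff lookup_nc_const_mult)
  then show "nc_extend l (nc_const a * p) = a * nc_extend l p"
    by (simp add: nc_extend_superset[of "Poly_Mapping.keys p"] lookup_nc_const_mult sum_distrib_left mult.assoc)
qed

lemma nc_extend_word [simp]: "nc_extend l (nc_word w) = l w"
  by (simp add: nc_extend_def nc_word_def)

lemma nc_extend_eq:
  assumes "linear_functional X m L" "\<And>w. w \<in> nc_words X m \<Longrightarrow> l w = L (nc_word w)"
    and "p \<in> nc_polys X m"
  shows "nc_extend l p = L p"
  using assms(3)
proof (induction rule: nc_polys_induct)
  case zero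
  have "L (nc_const 0 * 0) = 0 * L 0"
    using assms(1) unfolding linear_functional_def by (metis nc_polys_zero)
  then show ?case
    by (simp add: nc_extend.zero)
next
  case (add p q)
  then show ?case
    using assms(1) by (simp add: nc_extend.add linear_functional_def)
next
  case (word a w)
  then show ?case
    using assms(1,2) by (simp add: nc_extend.const_mult linear_functional_def)
qed

text \<open>All conditions on a state concern degree at most \<open>2 * r\<close> only, so values
  beyond that degree can be changed freely.\<close>

lemma tracial_states_cong:
  assumes L: "L \<in> tracial_states X r H" and eq: "\<And>p. p \<in> nc_polys X (2 * r) \<Longrightarrow> L' p = L p"
  shows "L' \<in> tracial_states X r H"
proof -
  have "linear_functional X (2 * r) L'"
    using L eq by (simp add: tracial_states_def linear_functional_def nc_polys_add nc_polys_const_mult)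
  moreover have "tracial_functional X (2 * r) L'"
    unfolding tracial_functional_def
  proof (intro allI impI)
    fix u v assume uv: "u @ v \<in> nc_words X (2 * r)"
    then have "v @ u \<in> nc_words X (2 * r)"
      by (auto simp: nc_words_def add.commute)
    then show "L' (nc_word u * nc_word v) = L' (nc_word v * nc_word u)"
      using L eq[of "nc_word (u @ v)"] eq[of "nc_word (v @ u)"] uv
      by (simp add: tracial_states_def tracial_functional_def flip: nc_word_append)
  qed
  moreover have "symmetric_functional X (2 * r) L'"
    using L eq by (simp add: tracial_states_def symmetric_functional_def)
  moreover have "positive_functional X r L'"
  proof -
    have "nc_star p * p \<in> nc_polys X (2 * r)" if "p \<in> nc_polys X r" for p
      using that by (intro nc_polys_mult[of _ _ r _ r]) (auto simp: mult_2)
    then show ?thesis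
      using L eq by (simp add: tracial_states_def positive_functional_def)
  qed
  moreover have "L' 1 = 1"
    using L eq[of 1] by (simp add: tracial_states_def)
  moreover have "L' q = 0" if "q \<in> truncated_ideal X (2 * r) H" for q
  proof -
    have "q \<in> nc_polys X (2 * r)"
      using that by (auto simp: truncated_ideal_def)
    then show ?thesis
      using L eq[of q] that by (simp add: tracial_states_def)
  qed
  ultimately show ?thesis
    by (simp add: tracial_states_def)
qed

lemma tracial_states_extend:
  assumes "L \<in> tracial_states X r H" "\<And>w. w \<in> nc_words X (2 * r) \<Longrightarrow> l w = L (nc_word w)"
  shows "nc_extend l \<in> tracial_states X r H"
  using assms(1)
proof (rule tracial_states_cong)
  show "nc_extend l p = L p" if "p \<in> nc_polys X (2 * r)" for p
    using assms that by (intro nc_extend_eq) (auto simp: tracial_states_def)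
qed

section \<open>Trace, Cauchy-Schwarz and vanishing on two-sided multiples\<close>

locale tracial_state = ncpoly_functional L for L :: "'v ncpoly \<Rightarrow> real" +
  fixes X :: "'v set" and r :: enat and H :: "'v ncpoly set"
  assumes state: "L \<in> tracial_states X r H"
begin

lemma one [simp]: "L 1 = 1"
  using state by (simp add: tracial_states_def)

lemma positive: "p \<in> nc_polys X r \<Longrightarrow> L (nc_star p * p) \<ge> 0"
  using state by (simp add: tracial_states_def positive_functional_def)

text \<open>Traciality is imposed on words and extends bilinearly. Both factors carry their own
  bound, since cancellation could hide long words in the product.\<close>

lemma trace:
  assumes "p \<in> nc_polys X a" "q \<in> nc_polys X b" "a + b \<le> 2 * r"
  shows "L (p * q) = L (q * p)"
  using assms(1)
proof (induction rule: nc_polys_induct)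
  case (word c u)
  have "L (nc_word u * q) = L (q * nc_word u)"
    using assms(2)
  proof (induction rule: nc_polys_induct)
    case (word d w)
    have "tracial_functional X (2 * r) L"
      using state by (simp add: tracial_states_def)
    then have "L (nc_word u * nc_word w) = L (nc_word w * nc_word u)"
      using nc_words_append[OF \<open>u \<in> _\<close> word assms(3)]
      unfolding tracial_functional_def by blast
    then show ?case
      by (simp add: const_mult mult.assoc nc_const_mult_left_commute[of "nc_word u"])
  qed (simp_all add: add distrib_left distrib_right)
  then show ?case
    by (simp add: const_mult mult.assoc nc_const_mult_left_commute[of q])
qed (simp_all add: add distrib_left distrib_right)

lemma star:
  assumes "p \<in> nc_polys X (2 * r)"
  shows "L (nc_star p) = L p"
  using assms
proof (induction rule: nc_polys_induct)
  case (word c u)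
  then have "L (nc_star (nc_word u)) = L (nc_word u)"
    using state by (simp add: tracial_states_def symmetric_functional_def)
  then show ?case
    by (simp add: nc_star_const_mult const_mult)
qed (simp_all add: nc_star_add add)

text \<open>Positivity at \<open>p + nc_const t * q\<close>, expanded; symmetry of \<open>L\<close>
  merges the two cross terms. Special values of \<open>t\<close> then replace the usual
  Cauchy-Schwarz inequality.\<close>

lemma discriminant:
  assumes p: "p \<in> nc_polys X r" and q: "q \<in> nc_polys X r"
  shows "0 \<le> L (nc_star p * p) + 2 * t * L (nc_star p * q) + t\<^sup>2 * L (nc_star q * q)"
proof -
  have "nc_star p * q \<in> nc_polys X (2 * r)"
    using assms by (intro nc_polys_mult[of _ _ r _ r]) (auto simp: mult_2)
  then have sym: "L (nc_star q * p) = L (nc_star p * q)"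
    using star[of "nc_star p * q"] by (simp add: nc_star_mult)
  have "nc_star (p + nc_const t * q) * (p + nc_const t * q) =
      nc_star p * p + nc_const t * (nc_star q * p) + (nc_const t * (nc_star p * q)
        + nc_const t * (nc_const t * (nc_star q * q)))"
    by (simp only: nc_star_add nc_star_const_mult distrib_left distrib_right mult.assoc
        nc_const_mult_left_commute[of "nc_star p"] nc_const_mult_left_commute[of "nc_star q"])
  then have "L (nc_star (p + nc_const t * q) * (p + nc_const t * q)) =
      L (nc_star p * p) + t * L (nc_star q * p) + t * L (nc_star p * q) + t * (t * L (nc_star q * q))"
    by (simp add: add const_mult)
  moreover have "p + nc_const t * q \<in> nc_polys X r"
    using assms by auto
  ultimately show ?thesis
    using positive[of "p + nc_const t * q"] sym by (simp add: power2_eq_square)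
qed

lemma null_vector:
  assumes p: "p \<in> nc_polys X r" and q: "q \<in> nc_polys X r" and "L (nc_star q * q) = 0"
  shows "L (nc_star p * q) = 0"
proof (rule ccontr)
  let ?A = "L (nc_star p * p)" and ?B = "L (nc_star p * q)"
  assume "?B \<noteq> 0"
  then show False
    \<comment> \<open>The quadratic term vanishes, and this \<open>t\<close> makes the remaining
      affine function equal to -1.\<close>
    using discriminant[OF p q, of "- (?A + 1) / (2 * ?B)"] assms(3) by (simp add: field_simps)
qed

text \<open>\<open>truncated_ideal\<close> contains left multiples only; the trace moves the right
  factor \<open>q\<close> round to the front.\<close>

lemma ideal:
  assumes "h \<in> H" "p \<in> nc_polys X a" "h \<in> nc_polys X d" "q \<in> nc_polys X b" "a + d + b \<le> 2 * r"
  shows "L (p * h * q) = 0"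
proof -
  have "L (p * h * q) = L (q * (p * h))"
    using assms by (intro trace[of _ "a + d" _ b] nc_polys_mult) auto
  also have "\<dots> = L ((q * p) * h)"
    by (simp add: mult.assoc)
  also have "\<dots> = 0"
  proof -
    have qp: "q * p \<in> nc_polys X (b + a)" and "q * p \<in> nc_polys X \<infinity>"
      using assms by (auto intro!: nc_polys_mult)
    moreover have "b + a + d \<le> 2 * r"
      using assms(5) by (simp add: ac_simps)
    with qp assms(3) have "(q * p) * h \<in> nc_polys X (2 * r)"
      by (rule nc_polys_mult)
    ultimately have "(q * p) * h \<in> truncated_ideal X (2 * r) H"
      using assms(1) unfolding truncated_ideal_def by blast
    then show ?thesis
      using state by (simp add: tracial_states_def)
  qed
  finally show ?thesis .
qed

end

text \<open>Cut after the first \<open>a\<close> letters; for infinite \<open>a\<close> the first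
  part is the whole word.\<close>

lemma nc_words_split:
  assumes "w \<in> nc_words X (a + b)"
  obtains u v where "w = u @ v" "u \<in> nc_words X a" "v \<in> nc_words X b"
proof (cases a)
  case (enat n)
  have "enat (length (drop n w)) \<le> b"
    using assms enat by (cases b) (auto simp: nc_words_def)
  moreover have "set (take n w) \<subseteq> X" "set (drop n w) \<subseteq> X"
    using assms set_take_subset[of n w] set_drop_subset[of n w] by (auto simp: nc_words_def)
  ultimately show ?thesis
    using that[of "take n w" "drop n w"] enat by (simp add: nc_words_def)
next
  case infinity
  then show ?thesis
    using assms that[of w "[]"] by (simp add: nc_words_def flip: zero_enat_def)
qed

text \<open>Degree count for a quadratic relation placed between the adjoint of \<open>q\<close> and
  \<open>q\<close>, where \<open>q\<close> has degree at most \<open>n\<close>.\<close>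

lemma enat_add_2_le_double:
  assumes "n + 1 \<le> r"
  shows "n + 2 + n \<le> 2 * (r :: enat)"
proof -
  have "n + 2 + n = (n + 1) + (n + 1)"
    by (simp add: ac_simps one_add_one)
  also have "\<dots> \<le> 2 * r"
    using add_mono[OF assms assms] by (simp only: mult_2)
  finally show ?thesis .
qed

subsection \<open>States on the stability relations\<close>

locale stable_state = tracial_state L W r "stab_relations W F"
  for L :: "'v ncpoly \<Rightarrow> real" and W r F +
  assumes r: "1 \<le> r"
begin

lemma idempotent:
  assumes "v \<in> W" "p \<in> nc_polys W a" "q \<in> nc_polys W b" "a + 2 + b \<le> 2 * r"
  shows "L (p * nc_var v * nc_var v * q) = L (p * nc_var v * q)"
proof -
  have "nc_var v \<in> nc_polys W 2" "nc_var v ^ 2 \<in> nc_polys W 2"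
    using assms(1) by (auto simp: power2_eq_square one_add_one intro!: nc_polys_mult[of _ _ 1 _ 1] nc_polys_var)
  then have "L (p * (nc_var v - nc_var v ^ 2) * q) = 0"
    using assms by (intro ideal[of _ _ a 2 _ b]) (auto simp: stab_relations_def)
  then show ?thesis
    by (simp add: left_diff_distrib right_diff_distrib diff power2_eq_square mult.assoc)
qed

lemma orthogonal:
  assumes "{v, w} \<in> F" "v \<in> W" "w \<in> W" "p \<in> nc_polys W a" "q \<in> nc_polys W b" "a + 2 + b \<le> 2 * r"
  shows "L (p * nc_var v * nc_var w * q) = 0"
proof -
  have "nc_var v * nc_var w \<in> nc_polys W 2"
    using assms by (auto simp: one_add_one intro!: nc_polys_mult[of _ _ 1 _ 1] nc_polys_var)
  then have "L (p * (nc_var v * nc_var w) * q) = 0"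
    using assms by (intro ideal[of _ _ a 2 _ b]) (auto simp: stab_relations_def)
  then show ?thesis
    by (simp add: mult.assoc)
qed

text \<open>Modulo the relations \<open>1 - x\<close> is a projection, so the difference of the two
  sides is the value of \<open>L\<close> on the hermitian square of
  \<open>(1 - x) * q\<close>.\<close>

lemma contraction:
  assumes "v \<in> W" "q \<in> nc_polys W a" "a + 1 \<le> r"
  shows "L (nc_star q * nc_var v * q) \<le> L (nc_star q * q)"
proof -
  have "(1 - nc_var v) * q \<in> nc_polys W r"
    using assms
    by (intro nc_polys_mult[of _ _ 1 _ a]) (auto simp: add.commute intro!: nc_polys_diff nc_polys_var)
  then have "0 \<le> L (nc_star ((1 - nc_var v) * q) * ((1 - nc_var v) * q))"
    by (rule positive)
  also have "nc_star ((1 - nc_var v) * q) * ((1 - nc_var v) * q) = nc_star q * q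
      - nc_star q * nc_var v * q - (nc_star q * nc_var v * q - nc_star q * nc_var v * nc_var v * q)"
    by (simp add: nc_star_mult nc_star_diff left_diff_distrib right_diff_distrib mult.assoc)
  also have "L \<dots> = L (nc_star q * q) - L (nc_star q * nc_var v * q)"
  proof -
    have "L (nc_star q * nc_var v * nc_var v * q) = L (nc_star q * nc_var v * q)"
      using assms by (intro idempotent[of _ _ a _ a] enat_add_2_le_double) auto
    then show ?thesis
      by (simp add: diff)
  qed
  finally show ?thesis
    by simp
qed

lemma word_contraction:
  assumes "u \<in> nc_words W a" "q \<in> nc_polys W b" "a + b \<le> r"
  shows "L (nc_star (nc_word u * q) * (nc_word u * q)) \<le> L (nc_star q * q)"
proof -
  \<comment> \<open>The bound is restated with the length of \<open>u\<close> instead of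
    \<open>a\<close>, so that the degree shrinks along with the word in the induction.\<close>
  have "L (nc_star (nc_word u * q) * (nc_word u * q)) \<le> L (nc_star q * q)"
    if "set u \<subseteq> W" "enat (length u) + b \<le> r"
    using that
  proof (induction u)
    case Nil
    have "nc_word [] * q = q"
      using nc_const_1 by (metis nc_const_def nc_word_def mult_1)
    then show ?case by simp
  next
    case (Cons v u)
    let ?q = "nc_word u * q"
    have le: "enat (length u) + b + 1 \<le> r"
      using Cons.prems(2) by (simp add: ac_simps eSuc_enat[symmetric] plus_1_eSuc iadd_Suc_right)
    then have le': "enat (length u) + b \<le> r"
      by (rule order_trans[rotated]) (simp add: add_increasing2)
    have u: "?q \<in> nc_polys W (enat (length u) + b)"
      using Cons.prems(1) assms(2) by (intro nc_polys_mult) (auto simp: nc_words_def)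
    have "nc_word (v # u) * q = nc_var v * ?q"
      using nc_word_append[of "[v]" u] by (simp add: nc_var_def mult.assoc)
    then have "L (nc_star (nc_word (v # u) * q) * (nc_word (v # u) * q)) =
        L (nc_star ?q * nc_var v * nc_var v * ?q)"
      by (simp add: nc_star_mult mult.assoc)
    \<comment> \<open>The outermost letter occurs squared in the middle: idempotence leaves one
      copy, and \<open>contraction\<close> removes it.\<close>
    also have "\<dots> = L (nc_star ?q * nc_var v * ?q)"
      using Cons.prems(1) u le
      by (intro idempotent[OF _ _ _ enat_add_2_le_double]) auto
    also have "\<dots> \<le> L (nc_star ?q * ?q)"
      using Cons.prems(1) u le by (intro contraction) auto
    also have "\<dots> \<le> L (nc_star q * q)"
      using Cons.prems(1) le' by (intro Cons.IH) auto
    finally show ?case .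
  qed
  moreover have "enat (length u) + b \<le> r"
    using assms(1,3) by (auto simp: nc_words_def intro: order_trans add_right_mono)
  ultimately show ?thesis
    using assms(1) by (simp add: nc_words_def)
qed

text \<open>Split the word into halves of degree at most \<open>r\<close>. The choices
  \<open>t = 1\<close> and \<open>t = -1\<close> in \<open>discriminant\<close> bound twice the
  absolute moment by the sum of two squared norms, each at most 1 by
  \<open>word_contraction\<close>. The first half is reversed because the involution reverses it
  back.\<close>

lemma abs_moment_le_1:
  assumes "w \<in> nc_words W (2 * r)"
  shows "\<bar>L (nc_word w)\<bar> \<le> 1"
proof -
  obtain u v where w: "w = u @ v" and u: "u \<in> nc_words W r" and v: "v \<in> nc_words W r"
    using assms nc_words_split unfolding mult_2 by metis
  have ru: "rev u \<in> nc_words W r"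
    using u by (simp add: nc_words_def)
  have *: "L (nc_star (nc_word t) * nc_word t) \<le> 1" if "t \<in> nc_words W r" for t
    using word_contraction[OF that, of 1 0] by simp
  have "nc_word w = nc_star (nc_word (rev u)) * nc_word v"
    by (simp add: w nc_star_word nc_word_append)
  then show ?thesis
    using discriminant[of "nc_word (rev u)" "nc_word v" 1] *[OF ru] *[OF v] ru v
      discriminant[of "nc_word (rev u)" "nc_word v" "-1"] by auto
qed

section \<open>Cliques: the complement \<open>1 - s\<close> of the sum \<open>s\<close> of a
  clique\<close>

context
  fixes C
  assumes finC: "finite C" and CW: "C \<subseteq> W"
    and clique: "\<And>v w. v \<in> C \<Longrightarrow> w \<in> C \<Longrightarrow> v \<noteq> w \<Longrightarrow> {v, w} \<in> F"
begin

lemma clique_complement_degree: "1 - (\<Sum>v\<in>C. nc_var v) \<in> nc_polys W 1"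
  using CW by (auto intro!: nc_polys_diff nc_polys_sum nc_polys_var)

text \<open>In \<open>x * (1 - s)\<close> the orthogonal products vanish and \<open>x - x^2\<close>
  vanishes as well; summing over the clique gives \<open>L (s * (1 - s)) = 0\<close>.\<close>

lemma clique_complement_idempotent:
  "L ((1 - (\<Sum>v\<in>C. nc_var v)) * (1 - (\<Sum>v\<in>C. nc_var v))) = L (1 - (\<Sum>v\<in>C. nc_var v))"
proof -
  have r2: "0 + 2 + 0 \<le> 2 * r"
    using r by (intro enat_add_2_le_double) simp
  have "L (nc_var v * (1 - (\<Sum>v\<in>C. nc_var v))) = 0" if "v \<in> C" for v
  proof -
    have "(\<Sum>w\<in>C. L (nc_var v * nc_var w)) = (\<Sum>w\<in>C. if w = v then L (nc_var v) else 0)"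
    proof (rule sum.cong)
      fix w assume "w \<in> C"
      then show "L (nc_var v * nc_var w) = (if w = v then L (nc_var v) else 0)"
        using idempotent[of v 1 0 1 0] orthogonal[of v w 1 0 1 0] clique[of v w] that CW r2
        by (auto simp: subset_iff)
    qed simp
    then show ?thesis
      using finC that by (simp add: right_diff_distrib diff sum sum_distrib_left)
  qed
  then have "L ((\<Sum>v\<in>C. nc_var v) * (1 - (\<Sum>v\<in>C. nc_var v))) = 0"
    by (simp add: sum_distrib_right sum)
  moreover have "(1 - (\<Sum>v\<in>C. nc_var v)) * (1 - (\<Sum>v\<in>C. nc_var v)) =
      (1 - (\<Sum>v\<in>C. nc_var v)) - (\<Sum>v\<in>C. nc_var v) * (1 - (\<Sum>v\<in>C. nc_var v))"
    by (simp only: left_diff_distrib mult_1_left)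
  ultimately show ?thesis
    by (simp only: diff[of _ "(\<Sum>v\<in>C. nc_var v) * (1 - (\<Sum>v\<in>C. nc_var v))"] diff_zero)
qed

lemma clique_complement_star: "nc_star (1 - (\<Sum>v\<in>C. nc_var v)) = 1 - (\<Sum>v\<in>C. nc_var v)"
  by (simp add: nc_star_diff nc_star_sum)

text \<open>\<open>L (1 - s)\<close> equals the value on a hermitian square and is therefore
  nonnegative.\<close>

lemma clique_sum_le_1: "(\<Sum>v\<in>C. L (nc_var v)) \<le> 1"
  using positive[OF nc_polys_mono[OF clique_complement_degree r]] clique_complement_idempotent
  by (simp add: clique_complement_star diff sum)

lemma clique_complement_null:
  assumes "(\<Sum>v\<in>C. L (nc_var v)) = 1" and "p \<in> nc_polys W a" "a + 1 \<le> 2 * r"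
  shows "L (p * (1 - (\<Sum>v\<in>C. nc_var v))) = 0"
proof -
  let ?s = "1 - (\<Sum>v\<in>C. nc_var v)"
  have ss: "L (?s * ?s) = 0"
    using assms(1) by (simp only: clique_complement_idempotent) (simp add: diff sum)
  \<comment> \<open>\<open>r'\<close> stands for \<open>r - 1\<close>, and is infinite when
    \<open>r\<close> is.\<close>
  obtain r' where r': "r = r' + 1"
    using r by (metis add.commute le_iff_add)
  have "L (nc_word w * ?s) = 0" if "w \<in> nc_words W a" for w
  proof -
    have "a \<le> r' + r"
      using assms(3) unfolding r' by (cases a; cases r') (auto simp: one_enat_def numeral_eq_enat)
    then have "w \<in> nc_words W (r' + r)"
      using that by (auto simp: nc_words_def intro: order_trans)
    \<comment> \<open>The unequal split leaves room for one more factor of degree 1: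
      \<open>?s * nc_word u\<close> still has degree at most \<open>r\<close>.\<close>
    then obtain u v where w: "w = u @ v" and u: "u \<in> nc_words W r'" and v: "v \<in> nc_words W r"
      by (rule nc_words_split)
    have vs: "nc_word v * ?s \<in> nc_polys W (r + 1)"
      using v clique_complement_degree by (intro nc_polys_mult) auto
    have su: "?s * nc_word u \<in> nc_polys W r"
      using u clique_complement_degree by (intro nc_polys_mult[of _ _ 1 _ r']) (auto simp: r' add.commute)
    have us: "nc_word (rev u) * ?s \<in> nc_polys W r"
      using u clique_complement_degree
      by (intro nc_polys_mult[of _ _ r' _ 1]) (auto simp: r' nc_words_def)
    have le: "r' + (r + 1) \<le> 2 * r"
      by (simp only: r' mult_2 add.commute add.left_commute add.assoc order_refl)
    have "L (nc_star (?s * nc_word u) * (?s * nc_word u)) = L ((nc_word (rev u) * ?s) * (?s * nc_word u))"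
      by (simp add: nc_star_mult clique_complement_star nc_star_word)
    \<comment> \<open>The trace turns the product inside out: the word now stands to the left of
      \<open>?s\<close> in a hermitian square, which is the shape that
      \<open>word_contraction\<close> handles.\<close>
    also have "\<dots> = L ((?s * nc_word u) * (nc_word (rev u) * ?s))"
      using us su by (rule trace) (simp add: mult_2)
    also have "\<dots> = L (nc_star (nc_word (rev u) * ?s) * (nc_word (rev u) * ?s))"
      by (simp add: nc_star_mult clique_complement_star nc_star_word)
    also have "\<dots> \<le> L (nc_star ?s * ?s)"
      using u clique_complement_degree by (intro word_contraction[of _ r' _ 1]) (auto simp: r' nc_words_def)
    also have "\<dots> = 0"
      by (simp only: clique_complement_star ss)
    finally have "L (nc_star (?s * nc_word u) * (?s * nc_word u)) = 0"
      using positive[OF su] by (rule antisym)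
    moreover have "nc_word (rev v) \<in> nc_polys W r"
      using v by (simp add: nc_words_def)
    ultimately have "L (nc_star (nc_word (rev v)) * (?s * nc_word u)) = 0"
      using null_vector[OF _ su] by blast
    \<comment> \<open>Rotating \<open>u\<close> to the end puts \<open>?s\<close> in the middle,
      where it pairs \<open>v\<close> with the null vector \<open>?s * nc_word u\<close>.\<close>
    moreover have "L (nc_word w * ?s) = L (nc_word v * ?s * nc_word u)"
      using trace[OF _ vs le] u by (simp add: w nc_word_append mult.assoc)
    ultimately show ?thesis
      by (simp add: nc_star_word mult.assoc)
  qed
  note * = this
  from assms(2) show ?thesis
  proof (induction rule: nc_polys_induct)
    case (add p q)
    then show ?case
      by (simp add: distrib_right additive.add[OF additive_axioms])
  next
    case (word b w)
    then show ?case
      by (simp only: mult.assoc const_mult * mult_zero_right)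
  qed (simp only: mult_zero_left additive.zero[OF additive_axioms])
qed

end

end

subsection \<open>Colourings and stable sets of the product with a complete graph\<close>

lemma sum_fibre: "(\<Sum>v\<in>Pair i ` {1..k}. f v) = (\<Sum>c\<in>{1..k}. f (i, c))" for k :: nat
  by (simp add: sum.reindex inj_on_def)

lemma lookup_nc_word: "Poly_Mapping.lookup (nc_word u) w = (if u = w then 1 else 0)"
  by (simp add: nc_word_def lookup_single when_def)

lemma one_le_double: "1 \<le> r \<Longrightarrow> 1 \<le> 2 * (r :: enat)"
  using add_mono[of 0 r 1 r] by (simp add: mult_2)

text \<open>A state may be arbitrary above degree \<open>2 * r\<close>. Replacing it by the
  extension of its moments makes it globally linear, as the locales require.\<close>

lemma obtain_ncpoly_functional:
  assumes "L \<in> tracial_states X r H"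
  obtains L' where "ncpoly_functional L'" "L' \<in> tracial_states X r H"
    "\<And>p. p \<in> nc_polys X (2 * r) \<Longrightarrow> L' p = L p"
proof
  show "ncpoly_functional (nc_extend (\<lambda>w. L (nc_word w)))" ..
  show "nc_extend (\<lambda>w. L (nc_word w)) \<in> tracial_states X r H"
    using assms by (rule tracial_states_extend) simp
  show "nc_extend (\<lambda>w. L (nc_word w)) p = L p" if "p \<in> nc_polys X (2 * r)" for p
    using assms that by (intro nc_extend_eq) (auto simp: tracial_states_def)
qed

text \<open>Only the ideal condition mentions the relations, so passing between the two relation
  sets comes down to a vanishing check.\<close>

lemma tracial_statesI:
  assumes "L \<in> tracial_states X r H" and "\<And>q. q \<in> truncated_ideal X (2 * r) H' \<Longrightarrow> L q = 0"
  shows "L \<in> tracial_states X r H'"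
  using assms by (simp add: tracial_states_def)

lemma box_complete_edges_iff:
  "{(i, c), (j, c')} \<in> box_complete_edges V E k \<longleftrightarrow>
    i \<in> V \<and> j \<in> V \<and> c \<in> {1..k} \<and> c' \<in> {1..k} \<and> (({i, j} \<in> E \<and> c = c') \<or> (i = j \<and> c \<noteq> c'))"
  by (auto simp: box_complete_edges_def doubleton_eq_iff insert_commute)

lemma edge_product_in_col_relations:
  "{(i, c), (j, c')} \<in> box_complete_edges V E k \<Longrightarrow>
    nc_var (i, c) * nc_var (j, c') \<in> col_relations V E k"
  unfolding box_complete_edges_iff col_relations_def by blast

section \<open>From colouring states to stability states and back\<close>

lemma col_state_imp_stab_state:
  fixes V :: "'v set"
  assumes L: "L \<in> tracial_states (V \<times> {1..k}) r (col_relations V E k)"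
    and fL: "ncpoly_functional L"
  shows "L \<in> tracial_states (box_complete_verts V k) r
      (stab_relations (box_complete_verts V k) (box_complete_edges V E k))"
  unfolding box_complete_verts_def
proof (rule tracial_statesI[OF L])
  let ?X = "V \<times> {1..k}"
  interpret tracial_state L ?X r "col_relations V E k"
    using L fL by (simp add: tracial_state_def tracial_state_axioms_def)
  fix q
  assume "q \<in> truncated_ideal ?X (2 * r) (stab_relations ?X (box_complete_edges V E k))"
  then obtain p h where q: "q = p * h" and p: "p \<in> nc_polys ?X \<infinity>"
    and h: "h \<in> stab_relations ?X (box_complete_edges V E k)" and ph: "p * h \<in> nc_polys ?X (2 * r)"
    unfolding truncated_ideal_def by blast
  consider (square) i c where "i \<in> V" "c \<in> {1..k}" "h = nc_var (i, c) - nc_var (i, c) ^ 2"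
    | (edge) i c j c' where "h = nc_var (i, c) * nc_var (j, c')"
        "{(i, c), (j, c')} \<in> box_complete_edges V E k"
    using h unfolding stab_relations_def by auto
  then show "L q = 0"
  proof cases
    case edge
    then have "h \<in> col_relations V E k"
      by (simp add: edge_product_in_col_relations)
    with p ph q have "q \<in> truncated_ideal ?X (2 * r) (col_relations V E k)"
      unfolding truncated_ideal_def by blast
    then show ?thesis
      using state by (simp add: tracial_states_def)
  next
    case square
    let ?v = "(i, c)"
    let ?s = "1 - (\<Sum>c'\<in>{1..k}. nc_var (i, c'))"
    have v: "nc_var ?v \<in> nc_polys ?X 1"
      using square by (intro nc_polys_var) auto
    have s: "?s \<in> nc_polys ?X 1" "?s \<in> col_relations V E k"
      using square by (auto intro!: nc_polys_diff nc_polys_sum nc_polys_var simp: col_relations_def)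
    show ?thesis
    proof (cases "p = 0")
      case False
      have "nc_var ?v ^ 2 = nc_word [?v, ?v]"
        by (simp add: power2_eq_square nc_var_def flip: nc_word_append)
      \<comment> \<open>The ideal bounds the degree of \<open>p * h\<close> only. A word of full
        degree 2 in \<open>h\<close> yields a bound on \<open>p\<close> itself, needed because
        \<open>h\<close> is about to be replaced by other relations.\<close>
      then have "[?v, ?v] \<in> Poly_Mapping.keys h" and "h \<in> nc_polys ?X (enat 2)"
        using square by (auto simp: nc_var_def in_keys_iff lookup_minus lookup_nc_word nc_words_def
            numeral_2_eq_2 intro!: nc_polys_diff)
      from nc_polys_mult_left_factor[OF p False ph this(2,1)]
      obtain a where a: "a + 2 \<le> 2 * r" "p \<in> nc_polys ?X a"
        by (auto simp: numeral_eq_enat)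
      \<comment> \<open>Separating the term \<open>c' = c\<close> isolates the square; all other
        terms are products of distinct colours at one vertex.\<close>
      have "nc_var ?v * (\<Sum>c'\<in>{1..k}. nc_var (i, c')) =
          nc_var ?v * nc_var ?v + (\<Sum>c'\<in>{1..k} - {c}. nc_var ?v * nc_var (i, c'))"
        using square by (simp add: sum_distrib_left distrib_left sum.remove[of _ c])
      then have "h = nc_var ?v * ?s + (\<Sum>c'\<in>{1..k} - {c}. nc_var ?v * nc_var (i, c'))"
        using square by (simp add: right_diff_distrib power2_eq_square)
      then have "q = (p * nc_var ?v) * ?s * 1 + (\<Sum>c'\<in>{1..k} - {c}. p * (nc_var ?v * nc_var (i, c')) * 1)"
        by (simp only: q distrib_left sum_distrib_left mult.assoc mult_1_right)
      moreover have "L ((p * nc_var ?v) * ?s * 1) = 0"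
      proof (rule ideal)
        show "p * nc_var ?v \<in> nc_polys ?X (a + 1)"
          using a v by (intro nc_polys_mult) auto
        show "a + 1 + 1 + 0 \<le> 2 * r"
          using a by (simp add: add.assoc one_add_one)
      qed (use s in auto)
      moreover have "L (p * (nc_var ?v * nc_var (i, c')) * 1) = 0" if "c' \<in> {1..k} - {c}" for c'
      proof (rule ideal)
        show "nc_var ?v * nc_var (i, c') \<in> col_relations V E k"
          using square that by (intro edge_product_in_col_relations) (auto simp: box_complete_edges_iff)
        show "nc_var ?v * nc_var (i, c') \<in> nc_polys ?X 2"
          using square that v
          by (intro nc_polys_mult[of _ _ 1 _ 1]) (auto intro: nc_polys_var simp: one_add_one)
        show "a + 2 + 0 \<le> 2 * r"
          using a by simp
      qed (use a in auto)
      ultimately show ?thesis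
        by (simp add: additive.add[OF additive_axioms] sum)
    qed (simp add: q additive.zero[OF additive_axioms])
  qed
qed

lemma col_state_sum:
  fixes V :: "'v set"
  assumes L: "L \<in> tracial_states (V \<times> {1..k}) r (col_relations V E k)"
    and fL: "ncpoly_functional L" and r: "1 \<le> r"
  shows "L (\<Sum>v\<in>V \<times> {1..k}. nc_var v) = card V"
proof -
  let ?X = "V \<times> {1..k}"
  interpret tracial_state L ?X r "col_relations V E k"
    using L fL by (simp add: tracial_state_def tracial_state_axioms_def)
  have "L (\<Sum>c\<in>{1..k}. nc_var (i, c)) = 1" if "i \<in> V" for i
  proof -
    have "L (1 * (1 - (\<Sum>c\<in>{1..k}. nc_var (i, c))) * 1) = 0"
    proof (rule ideal)
      show "1 - (\<Sum>c\<in>{1..k}. nc_var (i, c)) \<in> nc_polys ?X 1"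
        using that by (auto intro!: nc_polys_diff nc_polys_sum nc_polys_var)
      show "0 + 1 + 0 \<le> 2 * r"
        using one_le_double[OF r] by simp
    qed (use that in \<open>auto simp: col_relations_def\<close>)
    then show ?thesis
      by (simp add: diff)
  qed
  then have "(\<Sum>i\<in>V. \<Sum>c\<in>{1..k}. L (nc_var (i, c))) = card V"
    by (simp add: sum)
  then show ?thesis
    unfolding sum by (simp add: sum.cartesian_product)
qed

text \<open>The copies of one vertex form a clique in the product graph.\<close>

lemma stab_state_fibre_sum_le_1:
  fixes V :: "'v set"
  assumes "stable_state L (V \<times> {1..k}) r (box_complete_edges V E k)" and i: "i \<in> V"
  shows "(\<Sum>c\<in>{1..k}. L (nc_var (i, c))) \<le> 1"
proof -
  interpret stable_state L "V \<times> {1..k}" r "box_complete_edges V E k"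
    by fact
  have "(\<Sum>v\<in>Pair i ` {1..k}. L (nc_var v)) \<le> 1"
    by (rule clique_sum_le_1) (use i in \<open>auto simp: box_complete_edges_iff\<close>)
  then show ?thesis
    by (simp only: sum_fibre)
qed

lemma stab_state_imp_col_state:
  fixes V :: "'v set"
  assumes st: "stable_state L (V \<times> {1..k}) r (box_complete_edges V E k)"
    and "finite V" and k: "1 \<le> k" and sum_L: "L (\<Sum>v\<in>V \<times> {1..k}. nc_var v) = card V"
  shows "L \<in> tracial_states (V \<times> {1..k}) r (col_relations V E k)"
proof -
  let ?X = "V \<times> {1..k}"
  interpret stable_state L ?X r "box_complete_edges V E k"
    by fact
  have "(\<Sum>i\<in>V. \<Sum>c\<in>{1..k}. L (nc_var (i, c))) = (\<Sum>i\<in>V. 1)"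
    using sum_L unfolding sum by (simp add: sum.cartesian_product)
  \<comment> \<open>Each fibre contributes at most 1 and the total is \<open>card V\<close>, so no
    fibre can fall short.\<close>
  then have fibre: "(\<Sum>c\<in>{1..k}. L (nc_var (i, c))) = 1" if "i \<in> V" for i
    using stab_state_fibre_sum_le_1[OF st] that \<open>finite V\<close> by (rule sum_mono_inv)
  show ?thesis
  proof (rule tracial_statesI[OF state])
    fix q
    assume "q \<in> truncated_ideal ?X (2 * r) (col_relations V E k)"
    then obtain p h where q: "q = p * h" and p: "p \<in> nc_polys ?X \<infinity>"
      and h: "h \<in> col_relations V E k" and ph: "p * h \<in> nc_polys ?X (2 * r)"
      unfolding truncated_ideal_def by blast
    consider (sum) i where "i \<in> V" "h = 1 - (\<Sum>c\<in>{1..k}. nc_var (i, c))"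
      | (edge) i c j c' where "h = nc_var (i, c) * nc_var (j, c')"
          "{(i, c), (j, c')} \<in> box_complete_edges V E k"
      using h unfolding col_relations_def box_complete_edges_iff by blast
    then show "L q = 0"
    proof cases
      case edge
      then have "h \<in> stab_relations ?X (box_complete_edges V E k)"
        unfolding stab_relations_def by blast
      with p ph q have "q \<in> truncated_ideal ?X (2 * r) (stab_relations ?X (box_complete_edges V E k))"
        unfolding truncated_ideal_def by blast
      then show ?thesis
        using state by (simp add: tracial_states_def)
    next
      case sum
      show ?thesis
      proof (cases "p = 0")
        case False
        \<comment> \<open>Colour 1 exists because \<open>1 <= k\<close>, so \<open>h\<close> has a
          word of full degree 1 and \<open>p\<close> has degree at most
          \<open>2 * r - 1\<close>.\<close>
        have "Poly_Mapping.lookup h [(i, 1)] = - 1"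
          using k unfolding sum(2)
          by (simp add: lookup_minus lookup_sum lookup_one nc_var_def lookup_nc_word zero_list_def when_def)
        then have "[(i, 1)] \<in> Poly_Mapping.keys h"
          by (simp add: in_keys_iff)
        moreover have "h \<in> nc_polys ?X (enat 1)"
          using sum by (auto simp: one_enat_def intro!: nc_polys_diff nc_polys_sum nc_polys_var)
        ultimately obtain a where a: "a + 1 \<le> 2 * r" "p \<in> nc_polys ?X a"
          using nc_polys_mult_left_factor[OF p False ph, of 1 "[(i, 1)]"] by (auto simp: one_enat_def)
        have "L (p * (1 - (\<Sum>v\<in>Pair i ` {1..k}. nc_var v))) = 0"
        proof (rule clique_complement_null)
          show "(\<Sum>v\<in>Pair i ` {1..k}. L (nc_var v)) = 1"
            using fibre[OF sum(1)] by (simp only: sum_fibre)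
        qed (use sum(1) a in \<open>auto simp: box_complete_edges_iff\<close>)
        then show ?thesis
          by (simp only: q sum(2) sum_fibre)
      qed (simp add: q additive.zero[OF additive_axioms])
    qed
  qed
qed

subsection \<open>Attainment of the supremum\<close>

text \<open>For fixed \<open>p\<close> this is a finite linear combination of coordinates.\<close>

lemma continuous_on_nc_extend: "continuous_on UNIV (\<lambda>l. nc_extend l p)"
  unfolding nc_extend_def by (intro continuous_intros) (rule continuous_on_product_coordinates)

text \<open>The state conditions are an intersection of equations and weak inequalities between
  continuous functions of the moments; linearity holds automatically for
  \<open>nc_extend\<close>.\<close>

lemma closed_nc_extend_states: "closed {l. nc_extend l \<in> tracial_states X r H}"
proof -
  have eq: "closed {l. nc_extend l p = nc_extend l q}" for p q :: "'v ncpoly"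
    by (intro closed_Collect_eq continuous_on_nc_extend)
  have const: "closed {l. nc_extend l p = a}" for p :: "'v ncpoly" and a
    by (intro closed_Collect_eq continuous_on_nc_extend continuous_on_const)
  have pos: "closed {l. 0 \<le> nc_extend l p}" for p :: "'v ncpoly"
    by (intro closed_Collect_le continuous_on_nc_extend continuous_on_const)
  have lin: "linear_functional X m (nc_extend l)" for m l
    by (simp add: linear_functional_def nc_extend.add nc_extend.const_mult)
  show ?thesis
    unfolding tracial_states_def tracial_functional_def symmetric_functional_def
      positive_functional_def mem_Collect_eq Ball_def
    by (intro closed_Collect_conj closed_Collect_all closed_Collect_imp
        eq const pos open_Collect_const) (simp_all add: lin)
qed

text \<open>Tychonoff's theorem for the cube containing all moment sequences under
  consideration.\<close>

lemma compact_unit_cube: "compact (UNIV \<rightarrow>\<^sub>E {-1..1} :: ('a \<Rightarrow> real) set)"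
  using compactin_PiE[of "\<lambda>_ :: 'a. euclidean :: real topology" UNIV "\<lambda>_. {-1..1}"]
  by (simp add: euclidean_product_topology)

lemma stable_stateI:
  "ncpoly_functional L \<Longrightarrow> L \<in> tracial_states W r (stab_relations W F) \<Longrightarrow> 1 \<le> r \<Longrightarrow> stable_state L W r F"
  by (simp add: stable_state_def tracial_state_def tracial_state_axioms_def stable_state_axioms_def)

lemma xi_stab_attained:
  assumes r: "1 \<le> r" and ne: "tracial_states W r (stab_relations W F) \<noteq> {}"
  obtains L where "stable_state L W r F" "xi_stab r W F = ereal (L (\<Sum>v\<in>W. nc_var v))"
proof -
  let ?S = "tracial_states W r (stab_relations W F)" and ?x = "\<Sum>v\<in>W. nc_var v"
  define K :: "('a list \<Rightarrow> real) set" where "K = (UNIV \<rightarrow>\<^sub>E {-1..1}) \<inter> {l. nc_extend l \<in> ?S}"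
  have x: "?x \<in> nc_polys W (2 * r)"
    using one_le_double[OF r] by (auto intro!: nc_polys_sum nc_polys_var)
  have ex: "\<exists>l\<in>K. nc_extend l ?x = L ?x" if L: "L \<in> ?S" for L
  proof
    \<comment> \<open>Setting the moments above degree \<open>2 * r\<close> to 0 keeps the whole
      sequence in the cube while retaining the truncated state.\<close>
    let ?l = "\<lambda>w. if w \<in> nc_words W (2 * r) then L (nc_word w) else 0"
    obtain L' where L': "ncpoly_functional L'" "L' \<in> ?S"
      and eq: "\<And>p. p \<in> nc_polys W (2 * r) \<Longrightarrow> L' p = L p"
      using L obtain_ncpoly_functional by blast
    interpret stable_state L' W r F
      using L' r by (rule stable_stateI)
    have "\<bar>?l w\<bar> \<le> 1" for w
      using abs_moment_le_1[of w] eq[of "nc_word w"] by simp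
    then have "?l \<in> UNIV \<rightarrow>\<^sub>E {-1..1}"
      by (simp add: PiE_UNIV_domain Pi_iff abs_le_iff minus_le_iff del: if_split)
    moreover have "nc_extend ?l \<in> ?S"
      using L by (rule tracial_states_extend) simp
    ultimately show "?l \<in> K"
      by (simp add: K_def)
    show "nc_extend ?l ?x = L ?x"
      using L x by (intro nc_extend_eq) (auto simp: tracial_states_def)
  qed
  have "compact K"
    unfolding K_def by (intro compact_Int_closed compact_unit_cube closed_nc_extend_states)
  moreover have "K \<noteq> {}"
    using ne ex by blast
  moreover have "continuous_on K (\<lambda>l. nc_extend l ?x)"
    using continuous_on_nc_extend by (rule continuous_on_subset) simp
  ultimately have "\<exists>l\<in>K. \<forall>l'\<in>K. nc_extend l' ?x \<le> nc_extend l ?x"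
    by (rule continuous_attains_sup)
  then obtain l where l: "l \<in> K" and max: "\<And>l'. l' \<in> K \<Longrightarrow> nc_extend l' ?x \<le> nc_extend l ?x"
    by blast
  have lS: "nc_extend l \<in> ?S"
    using l by (simp add: K_def)
  show ?thesis
  proof
    show "stable_state (nc_extend l) W r F"
      using nc_extend.ncpoly_functional_axioms lS r by (rule stable_stateI)
    show "xi_stab r W F = ereal (nc_extend l ?x)"
      unfolding xi_stab_def
    proof (intro antisym SUP_least)
      show "ereal (L ?x) \<le> ereal (nc_extend l ?x)" if "L \<in> ?S" for L
        using ex[OF that] max by fastforce
      show "ereal (nc_extend l ?x) \<le> (SUP L\<in>?S. ereal (L ?x))"
        using lS by (rule SUP_upper)
    qed
  qed
qed

text \<open>The vertices of the product split into one fibre per vertex of the graph, each of total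
  value at most 1.\<close>

lemma xi_stab_box_le_card:
  fixes V :: "'v set"
  assumes "1 \<le> r"
  shows "xi_stab r (box_complete_verts V k) (box_complete_edges V E k) \<le> ereal (card V)"
  unfolding xi_stab_def box_complete_verts_def
proof (rule SUP_least)
  let ?X = "V \<times> {1..k}"
  fix L assume "L \<in> tracial_states ?X r (stab_relations ?X (box_complete_edges V E k))"
  then obtain L' where L': "ncpoly_functional L'"
      "L' \<in> tracial_states ?X r (stab_relations ?X (box_complete_edges V E k))"
    and eq: "\<And>p. p \<in> nc_polys ?X (2 * r) \<Longrightarrow> L' p = L p"
    using obtain_ncpoly_functional by blast
  have st: "stable_state L' ?X r (box_complete_edges V E k)"
    using L' assms by (rule stable_stateI)
  then interpret stable_state L' ?X r "box_complete_edges V E k" .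
  have "L (\<Sum>v\<in>?X. nc_var v) = L' (\<Sum>v\<in>?X. nc_var v)"
    using one_le_double[OF assms] by (intro eq[symmetric]) (auto intro!: nc_polys_sum nc_polys_var)
  also have "\<dots> = (\<Sum>i\<in>V. \<Sum>c\<in>{1..k}. L' (nc_var (i, c)))"
    unfolding sum by (simp add: sum.cartesian_product)
  also have "\<dots> \<le> (\<Sum>i\<in>V. 1)"
    using stab_state_fibre_sum_le_1[OF st] by (intro sum_mono)
  finally show "ereal (L (\<Sum>v\<in>?X. nc_var v)) \<le> ereal (card V)"
    by simp
qed

lemma col_feasible_iff:
  fixes V :: "'v set"
  assumes "finite V" "1 \<le> r" "1 \<le> k"
  shows "col_feasible r V E k \<longleftrightarrow>
    xi_stab r (box_complete_verts V k) (box_complete_edges V E k) = ereal (card V)"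
proof
  let ?X = "V \<times> {1..k}"
  assume "col_feasible r V E k"
  then obtain L where L: "ncpoly_functional L" "L \<in> tracial_states ?X r (col_relations V E k)"
    unfolding col_feasible_def using obtain_ncpoly_functional by blast
  have "ereal (L (\<Sum>v\<in>?X. nc_var v)) \<le>
      xi_stab r (box_complete_verts V k) (box_complete_edges V E k)"
    unfolding xi_stab_def
    using col_state_imp_stab_state[OF L(2,1)] by (intro SUP_upper2) (auto simp: box_complete_verts_def)
  then show "xi_stab r (box_complete_verts V k) (box_complete_edges V E k) = ereal (card V)"
    unfolding col_state_sum[OF L(2,1) assms(2)] using xi_stab_box_le_card[OF assms(2)] by (intro antisym)
next
  let ?X = "V \<times> {1..k}"
  assume xi: "xi_stab r (box_complete_verts V k) (box_complete_edges V E k) = ereal (card V)"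
  \<comment> \<open>Without states the supremum would be minus infinity, which is not a
    cardinality.\<close>
  then have "tracial_states ?X r (stab_relations ?X (box_complete_edges V E k)) \<noteq> {}"
    by (auto simp: xi_stab_def box_complete_verts_def bot_ereal_def)
  then obtain L where "stable_state L ?X r (box_complete_edges V E k)"
    "xi_stab r ?X (box_complete_edges V E k) = ereal (L (\<Sum>v\<in>?X. nc_var v))"
    using xi_stab_attained[OF assms(2)] by blast
  with xi assms show "col_feasible r V E k"
    using stab_state_imp_col_state[of L V k r E] by (auto simp: col_feasible_def box_complete_verts_def)
qed

subsection \<open>Colourings as states\<close>

context
  fixes f :: "'v \<Rightarrow> real"
begin

text \<open>The algebra homomorphism to the reals that sends each variable \<open>v\<close> to
  \<open>f v\<close>.\<close>

abbreviation evaluation :: "'v ncpoly \<Rightarrow> real" where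
  "evaluation \<equiv> nc_extend (\<lambda>w. prod_list (map f w))"

lemma evaluation_mult: "evaluation (p * q) = evaluation p * evaluation q"
proof -
  have word_mult: "evaluation (nc_word u * q) = evaluation (nc_word u) * evaluation q" for u
  proof (induction q rule: ncpoly_induct)
    case (word a w)
    have "evaluation (nc_word u * (nc_const a * nc_word w)) = a * evaluation (nc_word (u @ w))"
      by (simp only: nc_const_mult_left_commute[of "nc_word u"] nc_extend.const_mult nc_word_append)
    then show ?case
      by (simp add: nc_extend.const_mult)
  qed (simp_all add: nc_extend.zero nc_extend.add distrib_left)
  show ?thesis
  proof (induction p rule: ncpoly_induct)
    case (word a w)
    show ?case
      by (simp only: mult.assoc nc_extend.const_mult word_mult)
  qed (simp_all add: nc_extend.zero nc_extend.add distrib_right)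
qed

lemma evaluation_star: "evaluation (nc_star p) = evaluation p"
  by (induction p rule: ncpoly_induct)
    (simp_all add: nc_extend.zero nc_extend.add nc_star_add nc_star_const_mult nc_extend.const_mult
      nc_star_word rev_map[symmetric] prod_list.rev)

lemma evaluation_one: "evaluation 1 = 1"
  using nc_extend_word[of _ "[]"] by (metis list.simps(8) nc_const_1 nc_const_def nc_word_def prod_list.Nil)

lemma evaluation_const: "evaluation (nc_const a) = a"
  using nc_extend.const_mult[of "\<lambda>w. prod_list (map f w)" a 1] by (simp add: evaluation_one)

lemma evaluation_var: "evaluation (nc_var v) = f v"
  by (simp add: nc_var_def)

text \<open>Multiplicativity into a commutative ring gives traciality, makes hermitian squares
  evaluate to squares, and reduces the ideal condition to its generators.\<close>

lemma evaluation_state: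
  assumes "\<And>h. h \<in> H \<Longrightarrow> evaluation h = 0"
  shows "evaluation \<in> tracial_states X r H"
  unfolding tracial_states_def linear_functional_def tracial_functional_def
    symmetric_functional_def positive_functional_def truncated_ideal_def
  by (auto simp: nc_extend.add evaluation_const evaluation_mult evaluation_star evaluation_one
      mult.commute assms)

end

lemma colouring_imp_col_feasible:
  fixes V :: "'v set"
  assumes "\<And>i. i \<in> V \<Longrightarrow> col i \<in> {1..k}"
    and "\<And>i j. i \<in> V \<Longrightarrow> j \<in> V \<Longrightarrow> {i, j} \<in> E \<Longrightarrow> col i \<noteq> col j"
  shows "col_feasible r V E k"
proof -
  \<comment> \<open>The variable of vertex \<open>i\<close> and colour \<open>c\<close> is 1 exactly
    when \<open>c\<close> is the colour of \<open>i\<close>.\<close>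
  let ?f = "\<lambda>(i, c). of_bool (c = col i) :: real"
  have "evaluation ?f h = 0" if "h \<in> col_relations V E k" for h
    using that assms unfolding col_relations_def
    by (auto simp: evaluation_mult evaluation_var evaluation_one nc_extend.diff nc_extend.sum)
  then show ?thesis
    using evaluation_state unfolding col_feasible_def by blast
qed

text \<open>\<open>LEAST\<close> is informative only when some number qualifies, so the two
  existence claims make both sides genuine minima.\<close>

theorem proposition3p10:
  fixes V :: "'v set" and E :: "'v set set" and r :: enat
  assumes "finite_graph V E" and "1 \<le> r"
  shows "(\<exists>k\<ge>1. col_feasible r V E k) \<and>
    (\<exists>k\<ge>1. xi_stab r (box_complete_verts V k) (box_complete_edges V E k) = ereal (real (card V))) \<and>
    gamma_col r V E =
      (LEAST k. 1 \<le> k \<and>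
        xi_stab r (box_complete_verts V k) (box_complete_edges V E k) = ereal (real (card V)))"
proof -
  have fin: "finite V"
    using assms(1) by (simp add: finite_graph_def)
  then obtain col where col: "bij_betw col V {1..card V}"
    using ex_bij_betw_nat_finite_1 bij_betw_inv by blast
  \<comment> \<open>Giving all vertices different colours is proper, as edges have two distinct
    ends; the maximum with 1 covers the empty graph.\<close>
  have "col_feasible r V E (max 1 (card V))"
  proof (rule colouring_imp_col_feasible)
    show "col i \<in> {1..max 1 (card V)}" if "i \<in> V" for i
      using bij_betwE[OF col] that by fastforce
    show "col i \<noteq> col j" if "i \<in> V" "j \<in> V" "{i, j} \<in> E" for i j
    proof -
      have "i \<noteq> j"
        using assms(1) that(3) by (auto simp: finite_graph_def)
      then show ?thesis
        using col that by (auto simp: bij_betw_def inj_on_def)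
    qed
  qed
  then have feasible: "\<exists>k\<ge>1. col_feasible r V E k"
    using max.cobounded1 by blast
  have iff: "(1 \<le> k \<and> col_feasible r V E k) \<longleftrightarrow> (1 \<le> k \<and>
      xi_stab r (box_complete_verts V k) (box_complete_edges V E k) = ereal (card V))" for k
    using col_feasible_iff[OF fin assms(2)] by blast
  show ?thesis
    using feasible iff unfolding gamma_col_def by auto
qed

end
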